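(* Let $G$ be a connected chordal graph and let $C$ be a maximal clique of $G$. There exists a clique tree of $G$ of which $C$ is an endpoint if and only if $C$ is simply separated.
   Context: Graphs are finite, simple and undirected. Maximal cliques are regarded as subsets of the vertex set $V$; $\mathcal C$ is the set of all maximal cliques of $G$. A vertex $v$ is simplicial if its set of neighbors is a clique. For $C\in\mathcal C$, $\mathrm{Simp}(C)$ is the set of simplicial vertices of $G$ lying in $C$ and $\mathrm{Sep}(C)=C\setminus\mathrm{Simp}(C)$. A maximal clique $C$ with $\mathrm{Simp}(C)\ne\emptyset$ is called simply separated (or a boundary clique) if there exists a maximal clique $C'\in\mathcal C$ with $\mathrm{Sep}(C)=C\cap C'$. A clique tree of $G$ is a tree $T=(\mathcal C,\mathcal E)$ with node set $\mathcal C$ such that for all $C_1,C_2\in\mathcal C$ and every $C_3\in\mathcal C$ on the unique path in $T$ between $C_1$ and $C_2$, $C_1\cap C_2\subseteq C_3$. An endpoint of a tree is a node of degree $1$ (a leaf). *)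

theory Defs
  imports "Graph_Theory.Graph_Theory"
begin

text \<open>
  A finite simple undirected graph is a \<^locale>\<open>pair_graph\<close>: every undirected edge is
  represented by its two opposite arcs.  Under this encoding every edge yields a directed cycle of
  length 2, so the library's \<^const>\<open>forest\<close> and \<^const>\<open>tree\<close> describe oriented
  trees and do not apply; the cycles of the undirected graph are the directed cycles of length at
  least 3.
\<close>

definition undirected_tree :: "'a pair_pre_digraph \<Rightarrow> bool" where
  "undirected_tree T \<longleftrightarrow>
     pair_graph T \<and> connected T \<and> \<not> (\<exists>p. pre_digraph.cycle T p \<and> 3 \<le> length p)"

text \<open>A chord is an edge between two vertices of the cycle that is, in neither direction, an
  edge of the cycle.\<close>

definition chordal :: "'a pair_pre_digraph \<Rightarrow> bool" where
  "chordal G \<longleftrightarrow>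
     (\<forall>p. pre_digraph.cycle G p \<and> 4 \<le> length p \<longrightarrow>
        (\<exists>u \<in> fst ` set p. \<exists>v \<in> fst ` set p.
           (u, v) \<in> parcs G \<and> (u, v) \<notin> set p \<and> (v, u) \<notin> set p))"

definition clique :: "'a pair_pre_digraph \<Rightarrow> 'a set \<Rightarrow> bool" where
  "clique G K \<longleftrightarrow>
     K \<subseteq> pverts G \<and> (\<forall>u \<in> K. \<forall>v \<in> K. u \<noteq> v \<longrightarrow> (u, v) \<in> parcs G)"

definition maximal_cliques :: "'a pair_pre_digraph \<Rightarrow> 'a set set" where
  "maximal_cliques G = {C. clique G C \<and> (\<forall>K. clique G K \<and> C \<subseteq> K \<longrightarrow> K = C)}"

definition neighbors :: "'a pair_pre_digraph \<Rightarrow> 'a \<Rightarrow> 'a set" where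
  "neighbors G v = {u. (v, u) \<in> parcs G}"

definition simplicial :: "'a pair_pre_digraph \<Rightarrow> 'a \<Rightarrow> bool" where
  "simplicial G v \<longleftrightarrow> v \<in> pverts G \<and> clique G (neighbors G v)"

definition Simp :: "'a pair_pre_digraph \<Rightarrow> 'a set \<Rightarrow> 'a set" where
  "Simp G C = {v \<in> C. simplicial G v}"

definition Sep :: "'a pair_pre_digraph \<Rightarrow> 'a set \<Rightarrow> 'a set" where
  "Sep G C = C - Simp G C"

definition simply_separated :: "'a pair_pre_digraph \<Rightarrow> 'a set \<Rightarrow> bool" where
  "simply_separated G C \<longleftrightarrow>
     C \<in> maximal_cliques G \<and> Simp G C \<noteq> {} \<and>
     (\<exists>C' \<in> maximal_cliques G. Sep G C = C \<inter> C')"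

definition clique_tree :: "'a pair_pre_digraph \<Rightarrow> 'a set pair_pre_digraph \<Rightarrow> bool" where
  "clique_tree G T \<longleftrightarrow>
     undirected_tree T \<and> pverts T = maximal_cliques G \<and>
     (\<forall>C1 \<in> maximal_cliques G. \<forall>C2 \<in> maximal_cliques G. \<forall>p.
        pre_digraph.apath T C1 p C2 \<longrightarrow>
        (\<forall>C3 \<in> set (pawalk_verts C1 p). C1 \<inter> C2 \<subseteq> C3))"

text \<open>Since arcs come in opposite pairs, the undirected degree of a node is its out-degree.\<close>

definition endpoint :: "'a pair_pre_digraph \<Rightarrow> 'a \<Rightarrow> bool" where
  "endpoint T v \<longleftrightarrow> v \<in> pverts T \<and> out_degree T v = 1"

end

theory Submission
  imports Defs
begin

text \<open>
  A simplicial vertex lies in a single maximal clique, so \<open>Sep(C)\<close> is the part of \<open>C\<close> covered by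
  the other maximal cliques.  If \<open>C\<close> is a leaf of a clique tree with neighbour \<open>C'\<close>, then every
  path leaving \<open>C\<close> passes through \<open>C'\<close>, whence \<open>Sep(C) = C \<inter> C'\<close>.  Conversely, if
  \<open>Sep(C) = C \<inter> C'\<close>, then the maximal cliques of the chordal graph \<open>G - Simp(C)\<close> are exactly those of
  \<open>G\<close> other than \<open>C\<close>, and attaching \<open>C\<close> as a leaf at \<open>C'\<close> turns any clique tree of that graph into
  one of \<open>G\<close>.  Clique trees of chordal graphs come from eliminating simplicial vertices one by one.
\<close>

subsection \<open>Simplicial vertices of chordal graphs\<close>

text \<open>The cut creates a single new adjacent pair, \<open>(xs ! i, xs ! j)\<close>, and the
  last assumption covers it.\<close>

lemma successively_append_drop:
  assumes "successively P xs" "i < j" "j < length xs" "P (xs ! i) (xs ! j)"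
  shows "successively P (take (Suc i) xs @ drop j xs)"
proof -
  have "successively P (take (Suc i) xs)" "successively P (drop j xs)"
    using assms(1) by (metis append_take_drop_id successively_append_iff)+
  moreover have "last (take (Suc i) xs) = xs ! i" "hd (drop j xs) = xs ! j"
    using assms by (auto simp: take_Suc_conv_app_nth hd_drop_conv_nth)
  ultimately show ?thesis
    using assms(4) by (auto simp: successively_append_iff)
qed

lemma rtrancl_imp_successively:
  assumes "(a, b) \<in> (E \<inter> B \<times> B)\<^sup>*" "a \<in> B"
  obtains xs where "xs \<noteq> []" "hd xs = a" "last xs = b" "set xs \<subseteq> B"
    "successively (\<lambda>u v. (u, v) \<in> E) xs"
proof -
  have "\<exists>xs. xs \<noteq> [] \<and> hd xs = a \<and> last xs = b \<and> set xs \<subseteq> B \<and> successively (\<lambda>u v. (u, v) \<in> E) xs"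
    using assms(1)
  proof (induction rule: rtrancl_induct)
    case base
    show ?case using assms(2) by (intro exI[of _ "[a]"]) auto
  next
    case (step y z)
    then obtain xs where "xs \<noteq> []" "hd xs = a" "last xs = y" "set xs \<subseteq> B"
      "successively (\<lambda>u v. (u, v) \<in> E) xs" by blast
    with step(2) show ?case
      by (intro exI[of _ "xs @ [z]"]) (auto simp: successively_append_iff)
  qed
  with that show thesis by blast
qed

text \<open>Take \<open>L\<close> of minimal length among the lists in \<open>B\<close> with the
  given ends: a chord or a repeated vertex would allow a shortcut that keeps both ends. For
  symmetric \<open>E\<close> this yields an induced path.\<close>

lemma shortest_successively:
  fixes E :: "'a rel"
  assumes "xs \<noteq> []" "set xs \<subseteq> B" "successively (\<lambda>u v. (u, v) \<in> E) xs"
  obtains L where "L \<noteq> []" "hd L = hd xs" "last L = last xs" "set L \<subseteq> B"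
    "successively (\<lambda>u v. (u, v) \<in> E) L" "distinct L"
    "\<And>i j. Suc i < j \<Longrightarrow> j < length L \<Longrightarrow> (L ! i, L ! j) \<notin> E"
proof -
  let ?P = "\<lambda>L. L \<noteq> [] \<and> hd L = hd xs \<and> last L = last xs \<and> set L \<subseteq> B
    \<and> successively (\<lambda>u v. (u, v) \<in> E) L"
  define L where "L = arg_min length ?P"
  have PL: "?P L" and min: "\<And>M. ?P M \<Longrightarrow> length L \<le> length M"
    using arg_min_nat_lemma[of ?P xs length] assms by (auto simp: L_def)
  have nochord: "(L ! i, L ! j) \<notin> E" if ij: "Suc i < j" "j < length L" for i j
  proof
    assume E: "(L ! i, L ! j) \<in> E"
    have "?P (take (Suc i) L @ drop j L)"
      using PL ij E successively_append_drop[of "\<lambda>u v. (u, v) \<in> E" L i j]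
      by (auto dest: in_set_takeD in_set_dropD)
    from min[OF this] ij show False by simp
  qed
  have "L ! i \<noteq> L ! j" if ij: "i < j" "j < length L" for i j
  proof
    assume eq: "L ! i = L ! j"
    \<comment> \<open>The predecessor \<open>L ! k\<close> of \<open>L ! i\<close> is joined to
      \<open>L ! j\<close> because \<open>L ! i = L ! j\<close>; for \<open>i = 0\<close> a suffix
      of \<open>L\<close> remains.\<close>
    have "successively (\<lambda>u v. (u, v) \<in> E) (take i L @ drop j L)"
    proof (cases i)
      case 0
      then show ?thesis using PL by (metis append_Nil append_take_drop_id successively_append_iff take0)
    next
      case (Suc k)
      moreover have "(L ! k, L ! Suc k) \<in> E"
        using PL ij Suc by (simp add: successively_conv_nth)
      ultimately show ?thesis
        using successively_append_drop[of "\<lambda>u v. (u, v) \<in> E" L k j] PL ij eq by simp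
    qed
    moreover have "hd (take i L @ drop j L) = hd L"
      using PL ij eq by (cases "i = 0") (auto simp: hd_drop_conv_nth hd_conv_nth[symmetric])
    ultimately have "?P (take i L @ drop j L)"
      using PL ij by (auto dest: in_set_takeD in_set_dropD)
    from min[OF this] ij show False by simp
  qed
  then have "distinct L"
    by (metis distinct_conv_nth linorder_neqE_nat)
  with PL nochord that show thesis by blast
qed

lemma clique_mono: "clique G K \<Longrightarrow> L \<subseteq> K \<Longrightarrow> clique G L"
  by (auto simp: clique_def)

section \<open>Chordless cycles and simplicial vertices\<close>

context pair_graph
begin

lemma cas_map_upt:
  fixes f :: "nat \<Rightarrow> 'a"
  shows "pcas (f 0) (map (\<lambda>i. (f i, f (Suc i))) [0..<n]) (f n)"
proof (induction n)
  case (Suc n)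
  moreover have "last (pawalk_verts (f 0) (map (\<lambda>i. (f i, f (Suc i))) [0..<n])) = f n"
    using Suc awlast_if_cas by blast
  ultimately show ?case by (simp del: upt_Suc add: upt_Suc_append)
qed simp

text \<open>Translates chordality from cycles as arc lists to cyclic vertex lists: with distinct
  vertices, the arcs of the cycle are the pairs of positions \<open>i\<close> and
  \<open>Suc i mod length vs\<close>.\<close>

lemma chordal_cycleE:
  assumes "chordal G" "distinct vs" "4 \<le> length vs"
    and edge: "\<And>i. i < length vs \<Longrightarrow> (vs ! i, vs ! (Suc i mod length vs)) \<in> parcs G"
  obtains i j where "i < length vs" "j < length vs" "(vs ! i, vs ! j) \<in> parcs G"
    "j \<noteq> Suc i mod length vs" "i \<noteq> Suc j mod length vs"
proof -
  let ?n = "length vs"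
  define p where "p = map (\<lambda>i. (vs ! i, vs ! (Suc i mod ?n))) [0..<?n]"
  \<comment> \<open>Reducing both indices modulo \<open>?n\<close> exhibits \<open>p\<close> as the
    walk along a periodic sequence, which is closed because positions \<open>0\<close> and
    \<open>?n\<close> agree.\<close>
  have p': "p = map (\<lambda>i. (vs ! (i mod ?n), vs ! (Suc i mod ?n))) [0..<?n]"
    by (simp add: p_def)
  have cas: "pcas (vs ! 0) p (vs ! 0)"
    using cas_map_upt[of "\<lambda>i. vs ! (i mod ?n)" ?n] by (simp add: p')
  have sub: "set p \<subseteq> parcs G"
    using edge by (auto simp: p_def)
  have "p \<noteq> []" using assms(3) by (auto simp: p_def)
  have "vs ! 0 \<in> pverts G"
    using edge[of 0] assms(3) by (metis in_arcsD1 le_zero_eq not_gr_zero zero_neq_numeral)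
  then have walk: "awalk (vs ! 0) p (vs ! 0)"
    using cas sub by (simp add: awalk_def)
  have inj: "inj_on (\<lambda>i. Suc i mod ?n) {0..<?n}"
    by (rule inj_onI) (auto simp: mod_Suc split: if_splits)
  have "inj_on (\<lambda>i. vs ! (Suc i mod ?n)) {0..<?n}"
  proof (rule inj_onI)
    fix i j assume "i \<in> {0..<?n}" "j \<in> {0..<?n}" "vs ! (Suc i mod ?n) = vs ! (Suc j mod ?n)"
    moreover from this have "Suc i mod ?n < ?n" "Suc j mod ?n < ?n"
      by (auto intro!: mod_less_divisor simp del: length_greater_0_conv)
    ultimately show "i = j"
      using assms(2) inj by (auto simp: nth_eq_iff_index_eq dest: inj_onD)
  qed
  then have "distinct (map snd p)"
    by (simp add: p_def distinct_map comp_inj_on_iff[symmetric] o_def)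
  then have "distinct (tl (awalk_verts (vs ! 0) p))"
    using awalk_verts_conv'[OF cas] \<open>p \<noteq> []\<close> by simp
  then have "cycle p"
    using walk \<open>p \<noteq> []\<close> by (auto simp: cycle_def)
  moreover have "4 \<le> length p" using assms(3) by (simp add: p_def)
  ultimately obtain u v where uv: "u \<in> fst ` set p" "v \<in> fst ` set p" "(u, v) \<in> parcs G"
    "(u, v) \<notin> set p" "(v, u) \<notin> set p"
    using assms(1) unfolding chordal_def by blast
  from uv(1,2) obtain i j where ij: "i < ?n" "j < ?n" "u = vs ! i" "v = vs ! j"
    by (auto simp: p_def)
  with uv(4,5) have "j \<noteq> Suc i mod ?n" "i \<noteq> Suc j mod ?n"
    by (auto simp: p_def)
  with ij uv(3) that show thesis by blast
qed

text \<open>A shortest path from \<open>y\<close> to \<open>z\<close> through \<open>B\<close> closes up with \<open>x\<close> to a chordless cycle unless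
  \<open>y\<close> and \<open>z\<close> are adjacent.\<close>

lemma attachment_adjacent:
  assumes ch: "chordal G"
    and x: "x \<notin> B" "\<And>b. b \<in> B \<Longrightarrow> (x, b) \<notin> parcs G"
    and conn: "\<And>a b. a \<in> B \<Longrightarrow> b \<in> B \<Longrightarrow> (a, b) \<in> (parcs G \<inter> B \<times> B)\<^sup>*"
    and y: "(x, y) \<in> parcs G" "b \<in> B" "(b, y) \<in> parcs G"
    and z: "(x, z) \<in> parcs G" "c \<in> B" "(c, z) \<in> parcs G"
    and "y \<noteq> z"
  shows "(y, z) \<in> parcs G"
proof (rule ccontr)
  assume nyz: "(y, z) \<notin> parcs G"
  let ?E = "\<lambda>u v. (u, v) \<in> parcs G"
  obtain xs where xs: "xs \<noteq> []" "hd xs = b" "last xs = c" "set xs \<subseteq> B" "successively ?E xs"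
    using rtrancl_imp_successively[OF conn[OF y(2) z(2)] y(2)] by blast
  have "successively ?E (y # xs @ [z])"
    using xs y z arcs_symmetric
    by (auto simp: successively_append_iff successively_Cons)
  moreover have "set (y # xs @ [z]) \<subseteq> insert y (insert z B)"
    using xs by auto
  ultimately obtain L where L: "L \<noteq> []" "hd L = y" "last L = z" "set L \<subseteq> insert y (insert z B)"
    "successively ?E L" "distinct L"
    and nochord: "\<And>i j. Suc i < j \<Longrightarrow> j < length L \<Longrightarrow> \<not> ?E (L ! i) (L ! j)"
    using shortest_successively[of "y # xs @ [z]" "insert y (insert z B)" "parcs G"] by auto
  have L0: "L ! 0 = y" and Ll: "L ! (length L - 1) = z"
    using L by (simp_all add: hd_conv_nth last_conv_nth)
  have "length L \<noteq> 1" using L0 Ll \<open>y \<noteq> z\<close> by auto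
  moreover have "length L \<noteq> 2"
    using L0 Ll L(5) nyz by (force simp: successively_conv_nth)
  ultimately have len: "3 \<le> length L"
    using L(1) by (metis One_nat_def Suc_1 length_0_conv less_2_cases not_less_eq_eq numeral_3_eq_3
        nat_less_le)
  \<comment> \<open>By distinctness \<open>y\<close> and \<open>z\<close> occur only at the ends of
    \<open>L\<close>.\<close>
  have inner: "L ! k \<in> B" if "0 < k" "k < length L - 1" for k
  proof -
    have "k < length L" "0 < length L" "length L - 1 < length L" using that by auto
    then have "L ! k \<noteq> L ! 0" "L ! k \<noteq> L ! (length L - 1)"
      using L(6) that nth_eq_iff_index_eq by (metis less_irrefl)+
    moreover have "L ! k \<in> insert y (insert z B)"
      using L(4) that by (meson diff_le_self nth_mem order_less_le_trans subsetD)
    ultimately show ?thesis using L0 Ll by auto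
  qed
  \<comment> \<open>\<open>L\<close> has at least three vertices, so closing it with
    \<open>x\<close> gives a cycle long enough for chordality.\<close>
  let ?vs = "x # L"
  have "x \<notin> set L"
    using L(4) x(1) y(1) z(1) no_loops' by blast
  then have dist: "distinct ?vs" using L(6) by simp
  have edge: "?E (?vs ! i) (?vs ! (Suc i mod length ?vs))" if i: "i < length ?vs" for i
  proof -
    consider "i = 0" | "i = length L" | k where "i = Suc k" "Suc k < length L"
      using i by (cases i) (auto simp: less_Suc_eq)
    then show ?thesis
    proof cases
      case 1
      then show ?thesis using L0 L(1) y(1) by simp
    next
      case 2
      then show ?thesis using Ll L(1) z(1) arcs_symmetric by (simp add: nth_Cons')
    next
      case 3
      then show ?thesis using L(5) by (simp add: successively_conv_nth)
    qed
  qed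
  obtain i j where ij: "i < length ?vs" "j < length ?vs" "?E (?vs ! i) (?vs ! j)"
    "j \<noteq> Suc i mod length ?vs" "i \<noteq> Suc j mod length ?vs"
    using chordal_cycleE[OF ch dist _ edge] len by auto
  \<comment> \<open>A chord at \<open>x\<close> would lead to an inner vertex of \<open>L\<close>,
    hence into \<open>B\<close>, where \<open>x\<close> has no neighbours; any other chord would be
    a chord of \<open>L\<close>.\<close>
  have nc: False if ij: "i < j" "j < length ?vs" "?E (?vs ! i) (?vs ! j)"
    "j \<noteq> Suc i mod length ?vs" "i \<noteq> Suc j mod length ?vs" for i j
  proof -
    obtain k where k: "j = Suc k" using ij(1) by (cases j) auto
    show False
    proof (cases i)
      case 0
      have "k \<noteq> 0" using that(4) 0 k L(1) by auto
      moreover have "k \<noteq> length L - 1"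
      proof
        assume "k = length L - 1"
        then have "Suc j = length ?vs" using k L(1) by simp
        then show False using that(5) 0 by simp
      qed
      moreover have "k < length L" using ij(2) k by simp
      ultimately have "L ! k \<in> B" using inner[of k] by linarith
      then show False using that(3) 0 k x(2) by simp
    next
      case (Suc h)
      then have "Suc h < k" "k < length L"
        using that k by auto
      then show False using nochord[of h k] that(3) Suc k by simp
    qed
  qed
  have "i \<noteq> j" using ij(3) no_loops' by blast
  then show False
    using nc[of i j] nc[of j i] ij arcs_symmetric by (metis linorder_neqE_nat)
qed

text \<open>A variant of Dirac's lemma that needs no minimal separators: \<open>B\<close> is a component of the
  non-neighbours of \<open>x\<close> and \<open>Z\<close> is its boundary, a clique.  The induction hypothesis is
  applied to \<open>B \<union> Z\<close> and a vertex chosen such that the simplicial vertex found lies in \<open>B\<close>.\<close>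

lemma ex_simplicial_nonadjacent:
  assumes ch: "chordal G"
    and "finite S" "S \<subseteq> pverts G" "x \<in> S" "w \<in> S" "w \<noteq> x" "(x, w) \<notin> parcs G"
  shows "\<exists>s\<in>S. s \<noteq> x \<and> (x, s) \<notin> parcs G \<and> clique G (neighbors G s \<inter> S)"
  using assms(2-)
proof (induction S arbitrary: x w rule: finite_psubset_induct)
  case (psubset S)
  define R where "R = {r \<in> S. r \<noteq> x \<and> (x, r) \<notin> parcs G}"
  define B where "B = {b. (w, b) \<in> (parcs G \<inter> R \<times> R)\<^sup>*}"
  define Z where "Z = {z \<in> S. (x, z) \<in> parcs G \<and> (\<exists>b\<in>B. (b, z) \<in> parcs G)}"
  have wR: "w \<in> R" using psubset.prems by (auto simp: R_def)
  have wB: "w \<in> B" by (simp add: B_def)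
  have BR: "B \<subseteq> R"
  proof
    fix b assume "b \<in> B"
    then have "(w, b) \<in> (parcs G \<inter> R \<times> R)\<^sup>*" by (simp add: B_def)
    then show "b \<in> R" using wR by (cases rule: rtranclE) auto
  qed
  have Bclosed: "u \<in> B" if "b \<in> B" "u \<in> R" "(b, u) \<in> parcs G" for b u
  proof -
    have "(b, u) \<in> parcs G \<inter> R \<times> R" using that BR by auto
    then show ?thesis using that(1) by (auto simp: B_def intro: rtrancl_into_rtrancl)
  qed
  \<comment> \<open>A walk from \<open>w\<close> inside \<open>R\<close> never leaves
    \<open>B\<close>, so \<open>B\<close> is connected by arcs within \<open>B\<close>
    alone.\<close>
  have reach: "(w, b) \<in> (parcs G \<inter> B \<times> B)\<^sup>*" if "b \<in> B" for b
  proof -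
    have "(w, b) \<in> (parcs G \<inter> R \<times> R)\<^sup>*" using that by (simp add: B_def)
    then show ?thesis
    proof (induction rule: rtrancl_induct)
      case (step c d)
      then have "c \<in> B" "d \<in> B" by (auto simp: B_def intro: rtrancl_into_rtrancl)
      with step show ?case by (auto intro: rtrancl_into_rtrancl)
    qed simp
  qed
  have "sym (parcs G \<inter> B \<times> B)" using arcs_symmetric by (auto simp: sym_def)
  then have conn: "(a, b) \<in> (parcs G \<inter> B \<times> B)\<^sup>*" if "a \<in> B" "b \<in> B" for a b
    using reach[OF that(1)] reach[OF that(2)] by (meson rtrancl_trans sym_rtrancl symD)
  have xB: "x \<notin> B" "\<And>b. b \<in> B \<Longrightarrow> (x, b) \<notin> parcs G"
    using BR by (auto simp: R_def)
  have Zadj: "(y, z) \<in> parcs G" if "y \<in> Z" "z \<in> Z" "y \<noteq> z" for y z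
    using that attachment_adjacent[OF ch xB conn] unfolding Z_def by blast
  let ?S' = "B \<union> Z"
  have S'S: "?S' \<subset> S"
  proof -
    have "x \<notin> Z" using no_loops' by (auto simp: Z_def)
    moreover have "?S' \<subseteq> S" using BR by (auto simp: R_def Z_def)
    ultimately show ?thesis using xB(1) psubset.prems(2) by blast
  qed
  \<comment> \<open>Neighbours of \<open>b\<close> that are adjacent to \<open>x\<close> lie in
    \<open>Z\<close>, the others in \<open>B\<close>. Hence a vertex of \<open>B\<close> that is
    simplicial within \<open>B \<union> Z\<close> is simplicial within \<open>S\<close>.\<close>
  have nbr: "neighbors G b \<inter> S \<subseteq> ?S'" if "b \<in> B" for b
  proof
    fix u assume u: "u \<in> neighbors G b \<inter> S"
    then have bu: "(b, u) \<in> parcs G" "u \<in> S" by (auto simp: neighbors_def)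
    then have "u \<noteq> x" using xB(2)[OF that] arcs_symmetric by blast
    then show "u \<in> ?S'"
      using bu that Bclosed[OF that] by (cases "(x, u) \<in> parcs G") (auto simp: Z_def R_def)
  qed
  have lift: ?case if "b \<in> B" "clique G (neighbors G b \<inter> ?S')" for b
  proof -
    have "clique G (neighbors G b \<inter> S)"
      using nbr[OF that(1)] that(2) by (auto intro: clique_mono)
    then show ?thesis using that(1) BR by (auto simp: R_def)
  qed
  have IH: "\<exists>s\<in>?S'. s \<noteq> a \<and> (a, s) \<notin> parcs G \<and> clique G (neighbors G s \<inter> ?S')"
    if "a \<in> ?S'" "c \<in> ?S'" "c \<noteq> a" "(a, c) \<notin> parcs G" for a c
    using psubset.IH[OF S'S _ that] S'S psubset.prems by blast
  \<comment> \<open>If some \<open>z \<in> Z\<close> has a non-neighbour, the induction hypothesis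
    for \<open>z\<close> gives a vertex not adjacent to \<open>z\<close>, hence outside the clique
    \<open>Z\<close>.\<close>
  show ?case
  proof (cases "\<exists>z\<in>Z. \<exists>c\<in>?S'. c \<noteq> z \<and> (z, c) \<notin> parcs G")
    case True
    then obtain z where z: "z \<in> Z" "\<exists>c\<in>?S'. c \<noteq> z \<and> (z, c) \<notin> parcs G" by blast
    then obtain s where s: "s \<in> ?S'" "s \<noteq> z" "(z, s) \<notin> parcs G" "clique G (neighbors G s \<inter> ?S')"
      using IH[of z] by blast
    then have "s \<in> B" using Zadj z(1) by blast
    then show ?thesis using lift s(4) by blast
  next
    \<comment> \<open>Now each vertex of \<open>Z\<close> is adjacent to all others in
      \<open>B \<union> Z\<close>, so a vertex not adjacent to some \<open>a \<in> B\<close> cannot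
      lie in \<open>Z\<close>.\<close>
    case univ: False
    show ?thesis
    proof (cases "\<exists>a\<in>B. \<exists>c\<in>?S'. c \<noteq> a \<and> (a, c) \<notin> parcs G")
      case True
      then obtain a where a: "a \<in> B" "\<exists>c\<in>?S'. c \<noteq> a \<and> (a, c) \<notin> parcs G" by blast
      then obtain s where s: "s \<in> ?S'" "s \<noteq> a" "(a, s) \<notin> parcs G" "clique G (neighbors G s \<inter> ?S')"
        using IH[of a] by blast
      then have "s \<in> B" using univ a(1) arcs_symmetric by (metis UnE UnI1)
      then show ?thesis using lift s(4) by blast
    next
      case False
      \<comment> \<open>No non-adjacent pair is left, so \<open>w\<close> itself serves.\<close>
      have "clique G ?S'"
        unfolding clique_def
      proof (intro conjI ballI impI)
        show "?S' \<subseteq> pverts G" using S'S psubset.prems(1) by blast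
        show "(u, v) \<in> parcs G" if "u \<in> ?S'" "v \<in> ?S'" "u \<noteq> v" for u v
          using that False univ by (metis UnE)
      qed
      then have "clique G (neighbors G w \<inter> ?S')" by (rule clique_mono) blast
      then show ?thesis by (rule lift[OF wB])
    qed
  qed
qed

lemma ex_simplicial:
  assumes "chordal G" "finite S" "S \<subseteq> pverts G" "S \<noteq> {}"
  obtains s where "s \<in> S" "clique G (neighbors G s \<inter> S)"
proof (cases "clique G S")
  case True
  with assms(4) that show thesis by (meson all_not_in_conv clique_mono inf_le2)
next
  case False
  then obtain x w where "x \<in> S" "w \<in> S" "w \<noteq> x" "(x, w) \<notin> parcs G"
    using assms(3) by (auto simp: clique_def)
  with ex_simplicial_nonadjacent[OF assms(1-3)] that show thesis by blast
qed

end

subsection \<open>Trees on families of sets\<close>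

text \<open>The clique tree condition for an arbitrary family: trees are grown one set at a time,
  and the intermediate families need not be all maximal cliques of \<open>G\<close>.\<close>

definition junction_tree :: "'a set set \<Rightarrow> 'a set pair_pre_digraph \<Rightarrow> bool" where
  "junction_tree F T \<longleftrightarrow> undirected_tree T \<and> pverts T = F \<and>
     (\<forall>A\<in>F. \<forall>B\<in>F. \<forall>p. pre_digraph.apath T A p B \<longrightarrow>
        (\<forall>D\<in>set (pawalk_verts A p). A \<inter> B \<subseteq> D))"

lemma clique_tree_iff_junction_tree:
  "clique_tree G T \<longleftrightarrow> junction_tree (maximal_cliques G) T"
  by (auto simp: clique_tree_def junction_tree_def)

section \<open>Attaching a leaf to a tree\<close>

definition add_leaf :: "'a pair_pre_digraph \<Rightarrow> 'a \<Rightarrow> 'a \<Rightarrow> 'a pair_pre_digraph" where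
  "add_leaf T d c = \<lparr>pverts = insert c (pverts T), parcs = parcs T \<union> {(c, d), (d, c)}\<rparr>"

lemma add_leaf_simps [simp]:
  "pverts (add_leaf T d c) = insert c (pverts T)"
  "parcs (add_leaf T d c) = parcs T \<union> {(c, d), (d, c)}"
  by (simp_all add: add_leaf_def)

lemma (in pair_graph) mk_symmetric_eq: "mk_symmetric G = G"
proof -
  have "(\<Union>e\<in>parcs G. {e, (snd e, fst e)}) = parcs G"
    using arcs_symmetric by auto
  then show ?thesis by (simp add: mk_symmetric_def)
qed

text \<open>\<open>connected\<close> means strong connectivity of the symmetric closure, which here
  is the graph itself.\<close>

lemma (in pair_graph) connected_iff_reachable:
  "connected G \<longleftrightarrow> pverts G \<noteq> {} \<and> (\<forall>u\<in>pverts G. \<forall>v\<in>pverts G. u \<rightarrow>\<^sup>*\<^bsub>G\<^esub> v)"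
  by (simp add: connected_def mk_symmetric_eq strongly_connected_def)

locale pair_graph_leaf = pair_graph T for T :: "'a pair_pre_digraph" +
  fixes d c :: 'a
  assumes d: "d \<in> pverts T" and c: "c \<notin> pverts T"
begin

sublocale L: pair_graph "add_leaf T d c"
proof
  show "finite (pverts (add_leaf T d c))" "finite (parcs (add_leaf T d c))"
    by (simp_all add: pair_finite_verts pair_finite_arcs)
  show "symmetric (with_proj (add_leaf T d c))"
    using arcs_symmetric by (auto simp: symmetric_def sym_def)
qed (use d c in \<open>auto dest: wellformed' no_loops'\<close>)

lemma no_arcs_at_leaf: "(c, x) \<notin> parcs T" "(x, c) \<notin> parcs T"
  using c wellformed' by blast+

lemma leaf_arc_iff:
  "(c, x) \<in> parcs (add_leaf T d c) \<longleftrightarrow> x = d"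
  "(x, c) \<in> parcs (add_leaf T d c) \<longleftrightarrow> x = d"
  using no_arcs_at_leaf by (auto simp: add_leaf_def)

lemma endpoint_add_leaf: "endpoint (add_leaf T d c) c"
proof -
  have "out_arcs (add_leaf T d c) c = {(c, d)}"
    using no_arcs_at_leaf by (auto simp: out_arcs_def)
  then show ?thesis by (simp add: endpoint_def out_degree_def)
qed

text \<open>Every new arc has \<open>c\<close> as tail or head, and each tail on the walk is
  \<open>u\<close> or the head of the preceding arc.\<close>

lemma awalk_avoiding_leaf:
  assumes "L.awalk u p v" "u \<noteq> c" "c \<notin> snd ` set p"
  shows "awalk u p v"
  using assms
proof (induction p arbitrary: u)
  case Nil
  then show ?case by (auto simp: L.awalk_Nil_iff awalk_Nil_iff)
next
  case (Cons e p)
  obtain a b where e: "e = (a, b)" by force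
  with Cons.prems have "(a, b) \<in> parcs (add_leaf T d c)" "a = u" "L.awalk b p v" "b \<noteq> c"
    by (auto simp: L.awalk_Cons_iff)
  moreover from this have "(a, b) \<in> parcs T" using Cons.prems(2) by auto
  ultimately show ?case
    using Cons.IH[of b] Cons.prems(3) e by (auto simp: awalk_Cons_iff)
qed

lemma connected_add_leaf:
  assumes "connected T"
  shows "connected (add_leaf T d c)"
proof -
  have step: "u \<rightarrow>\<^sup>*\<^bsub>add_leaf T d c\<^esub> d" if u: "u \<in> pverts (add_leaf T d c)" for u
  proof (cases "u = c")
    case True
    have "L.awalk c [(c, d)] d" using d by (simp add: L.awalk_simps)
    with True show ?thesis using L.reachable_awalkI by blast
  next
    case False
    then have "u \<rightarrow>\<^sup>*\<^bsub>T\<^esub> d" using u d assms by (simp add: connected_iff_reachable)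
    then obtain p where "awalk u p d" by (auto simp: reachable_awalk)
    then have "L.awalk u p d" by (auto simp: awalk_def L.awalk_def)
    then show ?thesis using L.reachable_awalkI by blast
  qed
  moreover have "d \<rightarrow>\<^sup>*\<^bsub>add_leaf T d c\<^esub> u" if "u \<in> pverts (add_leaf T d c)" for u
    using step[OF that] L.awalk_rev_path L.reachable_awalk by metis
  ultimately show ?thesis
    unfolding L.connected_iff_reachable using L.reachable_trans[of _ d] by auto
qed

text \<open>A cycle through \<open>c\<close> enters and leaves \<open>c\<close> via
  \<open>d\<close>. The heads of its arcs are distinct, so only the cycle of length 2 could do
  this.\<close>

lemma cycle_add_leaf:
  assumes "L.cycle p" "3 \<le> length p"
  shows "cycle p"
proof -
  obtain u where u: "L.awalk u p u" "distinct (tl (L.awalk_verts u p))"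
    using assms(1) by (auto simp: L.cycle_def)
  have ne: "p \<noteq> []" using assms(2) by auto
  have tl: "tl (pawalk_verts u p) = map snd p"
    using u(1) ne L.awalk_verts_conv'[of u p u] by (auto simp: L.awalk_def)
  then have dist: "distinct (map snd p)" using u(2) by simp
  have last: "snd (last q) = w" if "L.awalk v q w" "q \<noteq> []" for v q w
    using L.awlast_of_awalk[OF that(1)] that(2) by (simp add: L.awalk_verts_conv)
  \<comment> \<open>Based at \<open>c\<close>, the cycle starts with \<open>(c, d)\<close> and ends
    with an arc from \<open>d\<close>; as its length is at least 3, the arcs in between reach
    \<open>d\<close> a second time.\<close>
  have uc: "u \<noteq> c"
  proof
    assume "u = c"
    then obtain q where q: "p = (c, d) # q" "L.awalk d q c"
      using u(1) ne leaf_arc_iff by (cases p) (auto simp: L.awalk_Cons_iff simp del: add_leaf_simps)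
    with assms(2) have "q \<noteq> []" by auto
    then obtain r e where r: "q = r @ [e]" by (metis rev_exhaust)
    then have "snd e = c" using last[OF q(2)] by simp
    moreover have re: "L.awalk d r (fst e)" "e \<in> parcs (add_leaf T d c)"
      using q(2) r by (auto simp: L.awalk_Cons_iff simp del: add_leaf_simps)
    ultimately have "fst e = d" using leaf_arc_iff by (metis prod.collapse)
    moreover have "r \<noteq> []" using assms(2) q r by auto
    ultimately have "snd (last r) = d" "last r \<in> set r" using last[OF re(1)] by auto
    then have "d \<in> snd ` set r" by (metis image_eqI)
    then show False using dist q r by simp
  qed
  have "c \<notin> snd ` set p"
  proof
    assume "c \<in> snd ` set p"
    then obtain p1 e q where p: "p = p1 @ e # q" "snd e = c"
      by (metis image_iff split_list)
    then have w: "L.awalk u p1 (fst e)" "e \<in> parcs (add_leaf T d c)" "L.awalk c q u"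
      using u(1) by (auto simp: L.awalk_Cons_iff simp del: add_leaf_simps)
    then have e: "fst e = d" using p(2) leaf_arc_iff by (metis prod.collapse)
    have "q \<noteq> []" using w(3) uc by (auto simp: L.awalk_Nil_iff)
    then obtain q' where q: "q = (c, d) # q'" "L.awalk d q' u"
      using w(3) leaf_arc_iff by (cases q) (auto simp: L.awalk_Cons_iff simp del: add_leaf_simps)
    \<comment> \<open>Besides \<open>(c, d)\<close>, a second arc has head \<open>d\<close>: the
      last one of \<open>p1\<close>, or, if \<open>p1\<close> is empty and the base point is
      \<open>d\<close>, the last one of \<open>q'\<close>.\<close>
    show False
    proof (cases "p1 = []")
      case False
      then have "d \<in> snd ` set p1" using last[OF w(1)] e by (metis image_eqI last_in_set)
      then show False using dist p q by auto
    next
      case True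
      then have "u = d" using w(1) e by (auto simp: L.awalk_Nil_iff)
      moreover have "q' \<noteq> []" using assms(2) True p q by auto
      ultimately have "d \<in> snd ` set q'" using last[OF q(2)] by (metis image_eqI last_in_set)
      then show False using dist p q by auto
    qed
  qed
  then have "awalk u p u" using awalk_avoiding_leaf[OF u(1) uc] by simp
  then show ?thesis using u(2) ne by (auto simp: cycle_def)
qed

lemma undirected_tree_add_leaf:
  assumes "undirected_tree T"
  shows "undirected_tree (add_leaf T d c)"
  using assms connected_add_leaf cycle_add_leaf L.pair_graph
  unfolding undirected_tree_def by blast

text \<open>A path with \<open>c\<close> in its interior would use two different neighbours of
  \<open>c\<close>, but \<open>d\<close> is the only one.\<close>

lemma apath_avoiding_leaf:
  assumes "L.apath u p v" "u \<noteq> c" "v \<noteq> c"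
  shows "apath u p v"
proof -
  have "c \<notin> snd ` set p"
  proof
    assume "c \<in> snd ` set p"
    then obtain x where x: "(x, c) \<in> set p" by auto
    then obtain p1 z p2 where p: "p = p1 @ (x, c) # (c, z) # p2" "x \<noteq> z"
      using L.apath_succ_decomp[OF assms(1)] assms(3) by metis
    then have "(x, c) \<in> parcs (add_leaf T d c)" "(c, z) \<in> parcs (add_leaf T d c)"
      using assms(1) by (auto simp: L.apath_def L.awalk_def simp del: add_leaf_simps)
    then show False using p(2) by (simp add: leaf_arc_iff del: add_leaf_simps)
  qed
  then show ?thesis
    using awalk_avoiding_leaf assms by (auto simp: apath_def L.apath_def)
qed

lemma apath_from_leaf:
  assumes "L.apath c p v" "v \<noteq> c"
  obtains q where "p = (c, d) # q" "apath d q v"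
proof -
  obtain e q where p: "p = e # q" using assms by (cases p) (auto simp: L.apath_Nil_iff)
  then have "e = (c, d)" "L.apath d q v"
    using assms leaf_arc_iff by (cases e; auto simp: L.apath_Cons_iff simp del: add_leaf_simps)+
  moreover have "d \<noteq> c" using d c by auto
  ultimately show thesis
    using that p apath_avoiding_leaf assms(2) by blast
qed

end

text \<open>A path from \<open>C\<close> to \<open>B\<close> continues from \<open>D\<close> inside
  \<open>T\<close>, so its later nodes contain \<open>D \<inter> B\<close>, and this contains
  \<open>C \<inter> B\<close>. Paths ending in \<open>C\<close> are reversed.\<close>

lemma junction_tree_add_leaf:
  assumes "junction_tree F T" "D \<in> F" "C \<notin> F" "C \<inter> \<Union> F \<subseteq> D"
  shows "junction_tree (insert C F) (add_leaf T D C)" "endpoint (add_leaf T D C) C"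
proof -
  have T: "undirected_tree T" "pverts T = F"
    and path: "\<And>A B p X. A \<in> F \<Longrightarrow> B \<in> F \<Longrightarrow> pre_digraph.apath T A p B \<Longrightarrow>
      X \<in> set (pawalk_verts A p) \<Longrightarrow> A \<inter> B \<subseteq> X"
    using assms(1) unfolding junction_tree_def by blast+
  interpret pair_graph T using T(1) by (simp add: undirected_tree_def)
  interpret pair_graph_leaf T D C
    using assms T by unfold_locales auto
  show "endpoint (add_leaf T D C) C" by (rule endpoint_add_leaf)
  have leaf: "C \<inter> B \<subseteq> X" if B: "B \<in> F" "L.apath C p B" and X: "X \<in> set (pawalk_verts C p)" for B p X
  proof -
    obtain q where q: "p = (C, D) # q" "apath D q B"
      using apath_from_leaf[OF B(2)] B(1) assms(3) by metis
    show ?thesis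
    proof (cases "X = C")
      case False
      then have "D \<inter> B \<subseteq> X" using path[OF assms(2) B(1) q(2)] X q(1) by simp
      then show ?thesis using assms(4) B(1) by blast
    qed simp
  qed
  have "A \<inter> B \<subseteq> X" if AB: "A \<in> insert C F" "B \<in> insert C F" and p: "L.apath A p B"
    and X: "X \<in> set (pawalk_verts A p)" for A B p X
  proof -
    consider "A = C" "B = C" | "A = C" "B \<in> F" | "A \<in> F" "B = C" | "A \<in> F" "B \<in> F"
      using AB by blast
    then show ?thesis
    proof cases
      case 1
      then show ?thesis using p X L.apath_nonempty_ends[OF p] by (cases "p = []") auto
    next
      case 2
      then show ?thesis using leaf p X by blast
    next
      case 3
      have "L.apath C (rev_path p) A" "X \<in> set (pawalk_verts C (rev_path p))"
        using p X 3 L.awalk_verts_rev_path[of A p C] by (auto simp: L.apath_def)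
      then show ?thesis using leaf[OF 3(1)] 3(2) by blast
    next
      case 4
      then have "apath A p B" using apath_avoiding_leaf[OF p] assms(3) by blast
      then show ?thesis using path 4 X by blast
    qed
  qed
  then show "junction_tree (insert C F) (add_leaf T D C)"
    using undirected_tree_add_leaf[OF T(1)] T(2) unfolding junction_tree_def by simp
qed

lemma junction_tree_singleton: "junction_tree {A} \<lparr>pverts = {A}, parcs = {}\<rparr>"
proof -
  let ?T = "\<lparr>pverts = {A}, parcs = {}\<rparr>"
  interpret pair_graph ?T by unfold_locales (auto simp: symmetric_def)
  have "connected ?T" by (simp add: connected_iff_reachable reachable_refl)
  moreover have "\<not> cycle p" for p by (auto simp: cycle_def awalk_def)
  ultimately show ?thesis
    by (auto simp: junction_tree_def undirected_tree_def pair_graph apath_def awalk_def)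
qed

text \<open>Compared with junction trees, this form makes it easy to replace a member of the family by a
  larger set.\<close>

inductive running_intersection :: "'a set set \<Rightarrow> bool" where
  singleton: "running_intersection {A}"
| insert: "running_intersection F \<Longrightarrow> D \<in> F \<Longrightarrow> C \<notin> F \<Longrightarrow> C \<inter> \<Union> F \<subseteq> D \<Longrightarrow>
    running_intersection (insert C F)"

lemma running_intersection_junction_tree:
  "running_intersection F \<Longrightarrow> \<exists>T. junction_tree F T"
  by (induction rule: running_intersection.induct)
    (blast intro: junction_tree_singleton junction_tree_add_leaf)+

text \<open>The fresh \<open>v\<close> lies in no other member, so no intersection of distinct
  members changes and the sets can be attached in the same order.\<close>

lemma running_intersection_add_fresh:
  assumes "running_intersection F" "A \<in> F" "v \<notin> \<Union> F"
  shows "running_intersection (insert (insert v A) (F - {A}))"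
  using assms
proof (induction arbitrary: A rule: running_intersection.induct)
  case (singleton B)
  then show ?case by (auto intro: running_intersection.singleton)
next
  case (insert F D C)
  show ?case
  proof (cases "A = C")
    case True
    have "running_intersection (insert (insert v C) F)"
      using insert by (intro running_intersection.insert[of F D]) auto
    then show ?thesis using True insert.hyps(3) by simp
  next
    case False
    let ?F = "insert (insert v A) (F - {A})"
    have "running_intersection (insert C ?F)"
    proof (rule running_intersection.insert)
      show "running_intersection ?F" using insert False by auto
      \<comment> \<open>If \<open>C\<close> was attached to the set being enlarged, it is now
        attached to the enlarged set.\<close>
      show "(if D = A then insert v A else D) \<in> ?F" using insert.hyps by auto
      show "C \<notin> ?F" using insert by auto
      show "C \<inter> \<Union> ?F \<subseteq> (if D = A then insert v A else D)"
        using insert False by auto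
    qed
    moreover have "insert C ?F = insert (insert v A) (insert C F - {A})"
      using False by auto
    ultimately show ?thesis by simp
  qed
qed

subsection \<open>Maximal cliques\<close>

text \<open>The maximal cliques of the subgraph induced by \<open>S\<close>. Keeping
  \<open>G\<close> fixed avoids transferring chordality to subgraphs.\<close>

definition maximal_cliques_in :: "'a pair_pre_digraph \<Rightarrow> 'a set \<Rightarrow> 'a set set" where
  "maximal_cliques_in G S =
     {K. K \<subseteq> S \<and> clique G K \<and> (\<forall>L. L \<subseteq> S \<and> clique G L \<and> K \<subseteq> L \<longrightarrow> L = K)}"

lemma maximal_cliques_inI:
  assumes "K \<subseteq> S" "clique G K" "\<And>L. L \<subseteq> S \<Longrightarrow> clique G L \<Longrightarrow> K \<subseteq> L \<Longrightarrow> L = K"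
  shows "K \<in> maximal_cliques_in G S"
  using assms by (simp add: maximal_cliques_in_def)

lemma maximal_cliques_inD:
  assumes "K \<in> maximal_cliques_in G S"
  shows "K \<subseteq> S" "clique G K" "L \<subseteq> S \<Longrightarrow> clique G L \<Longrightarrow> K \<subseteq> L \<Longrightarrow> L = K"
  using assms by (simp_all add: maximal_cliques_in_def)

lemma maximal_cliques_in_pverts: "maximal_cliques_in G (pverts G) = maximal_cliques G"
  by (auto simp: maximal_cliques_in_def maximal_cliques_def clique_def)

lemma maximal_cliques_in_extend:
  assumes "finite S" "K \<subseteq> S" "clique G K"
  obtains D where "D \<in> maximal_cliques_in G S" "K \<subseteq> D"
proof -
  have "finite {L. L \<subseteq> S \<and> clique G L}" using assms(1) by simp
  from finite_has_maximal2[OF this, of K] assms(2,3) obtain D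
    where "D \<subseteq> S" "clique G D" "K \<subseteq> D" "\<And>L. L \<subseteq> S \<Longrightarrow> clique G L \<Longrightarrow> D \<subseteq> L \<Longrightarrow> D = L"
    by auto
  then have "D \<in> maximal_cliques_in G S" by (intro maximal_cliques_inI) auto
  with \<open>K \<subseteq> D\<close> that show thesis by blast
qed

context pair_graph
begin

lemma clique_insert_neighbors:
  assumes "s \<in> pverts G" "clique G N" "N \<subseteq> neighbors G s"
  shows "clique G (insert s N)"
  using assms arcs_symmetric by (auto simp: clique_def neighbors_def)

lemma clique_subset_neighbors:
  "clique G L \<Longrightarrow> s \<in> L \<Longrightarrow> L \<subseteq> insert s (neighbors G s)"
  by (auto simp: clique_def neighbors_def)

text \<open>Each clique through \<open>s\<close> lies in the clique \<open>insert s N\<close>. Among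
  the maximal cliques of \<open>S\<close>, only \<open>N\<close> can lose its maximality, since any
  other would have to be contained in \<open>N\<close>.\<close>

lemma maximal_cliques_in_insert_simplicial:
  assumes "s \<in> pverts G" "s \<notin> S" and N: "clique G N" "N = neighbors G s \<inter> S"
  shows "maximal_cliques_in G (insert s S) = insert (insert s N) (maximal_cliques_in G S - {N})"
proof -
  have sN: "clique G (insert s N)" using assms by (intro clique_insert_neighbors) auto
  have le: "L \<subseteq> insert s N" if "L \<subseteq> insert s S" "clique G L" "s \<in> L" for L
    using clique_subset_neighbors[OF that(2,3)] that(1) N(2) by blast
  have NS: "N \<subseteq> S" "s \<notin> N" using N assms(2) by auto
  show ?thesis
  proof (intro equalityI subsetI)
    fix K assume K: "K \<in> maximal_cliques_in G (insert s S)"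
    note KS = maximal_cliques_inD(1,2)[OF K] and max = maximal_cliques_inD(3)[OF K]
    show "K \<in> insert (insert s N) (maximal_cliques_in G S - {N})"
    proof (cases "s \<in> K")
      case True
      then have "K \<subseteq> insert s N" using le KS by blast
      moreover have "insert s N \<subseteq> insert s S" using NS(1) by blast
      ultimately have "insert s N = K" using max sN by blast
      then show ?thesis by simp
    next
      case False
      have "insert s N \<subseteq> insert s S" using NS(1) by blast
      then have "K \<noteq> N" using max[OF _ sN] NS(2) by blast
      moreover have "K \<in> maximal_cliques_in G S"
        using False KS by (intro maximal_cliques_inI max) auto
      ultimately show ?thesis by simp
    qed
  next
    fix K assume "K \<in> insert (insert s N) (maximal_cliques_in G S - {N})"
    then consider "K = insert s N" | "K \<in> maximal_cliques_in G S" "K \<noteq> N" by blast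
    then show "K \<in> maximal_cliques_in G (insert s S)"
    proof cases
      case 1
      show ?thesis unfolding 1
      proof (rule maximal_cliques_inI)
        show "insert s N \<subseteq> insert s S" using NS(1) by blast
        show "L = insert s N" if "L \<subseteq> insert s S" "clique G L" "insert s N \<subseteq> L" for L
          using le[OF that(1,2)] that(3) by blast
      qed (rule sN)
    next
      case 2
      note KS = maximal_cliques_inD(1,2)[OF 2(1)] and max = maximal_cliques_inD(3)[OF 2(1)]
      have "L = K" if L: "L \<subseteq> insert s S" "clique G L" "K \<subseteq> L" for L
      proof (cases "s \<in> L")
        case True
        then have "K \<subseteq> N" using le[OF L(1,2)] L(3) KS(1) assms(2) by blast
        then show ?thesis using max[OF NS(1) N(1)] 2(2) by blast
      next
        case False
        then show ?thesis using max[OF _ L(2,3)] L(1) by blast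
      qed
      then show ?thesis using KS by (intro maximal_cliques_inI) auto
    qed
  qed
qed

text \<open>Restoring a simplicial vertex \<open>s\<close> either enlarges the maximal clique
  \<open>N\<close> by the fresh element \<open>s\<close> or, if \<open>N\<close> was not maximal,
  attaches \<open>insert s N\<close> to a maximal clique containing \<open>N\<close>.\<close>

lemma running_intersection_maximal_cliques_in:
  assumes "chordal G" "finite S" "S \<subseteq> pverts G"
  shows "running_intersection (maximal_cliques_in G S)"
  using assms(2,3)
proof (induction S rule: finite_psubset_induct)
  case (psubset S)
  show ?case
  proof (cases "S = {}")
    case True
    \<comment> \<open>The empty clique is maximal here, so the family is a singleton rather than
      empty.\<close>
    then have "maximal_cliques_in G S = {{}}" by (auto simp: maximal_cliques_in_def clique_def)
    then show ?thesis by (simp add: running_intersection.singleton)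
  next
    case False
    then obtain s where s: "s \<in> S" "clique G (neighbors G s \<inter> S)"
      using ex_simplicial[OF assms(1) psubset.hyps psubset.prems] by blast
    define S' where "S' = S - {s}"
    define N where "N = neighbors G s \<inter> S'"
    let ?F = "maximal_cliques_in G S'"
    have N: "clique G N" "N \<subseteq> S'" using s(2) by (auto simp: N_def S'_def intro: clique_mono)
    have F: "running_intersection ?F"
      unfolding S'_def using psubset s(1) by (intro psubset.IH) auto
    have sF: "s \<notin> \<Union> ?F" by (auto simp: maximal_cliques_in_def S'_def)
    have "maximal_cliques_in G (insert s S') = insert (insert s N) (?F - {N})"
      using s(1) psubset.prems N(1)
      by (intro maximal_cliques_in_insert_simplicial) (auto simp: N_def S'_def)
    then have eq: "maximal_cliques_in G S = insert (insert s N) (?F - {N})"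
      using s(1) by (simp add: S'_def insert_absorb)
    show ?thesis
    proof (cases "N \<in> ?F")
      case True
      then show ?thesis using eq running_intersection_add_fresh[OF F _ sF] by simp
    next
      case False
      obtain D where D: "D \<in> ?F" "N \<subseteq> D"
        using maximal_cliques_in_extend[OF _ N(2,1)] psubset.hyps by (auto simp: S'_def)
      have "running_intersection (insert (insert s N) ?F)"
        using sF D by (intro running_intersection.insert[OF F D(1)]) auto
      then show ?thesis using eq False by simp
    qed
  qed
qed

section \<open>Simply separated cliques and leaves of clique trees\<close>

text \<open>If \<open>v\<close> is simplicial, its closed neighbourhood is a clique containing every
  clique through \<open>v\<close>. Conversely, each neighbour shares a maximal clique with
  \<open>v\<close>; if this is always \<open>C\<close>, all neighbours lie in the clique
  \<open>C\<close>.\<close>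

lemma simplicial_iff_unique_maximal_clique:
  assumes "C \<in> maximal_cliques G" "v \<in> C"
  shows "simplicial G v \<longleftrightarrow> (\<forall>D\<in>maximal_cliques G. v \<in> D \<longrightarrow> D = C)"
proof
  have v: "v \<in> pverts G" using assms by (auto simp: maximal_cliques_def clique_def)
  {
    assume "simplicial G v"
    then have K: "clique G (insert v (neighbors G v))"
      by (intro clique_insert_neighbors) (auto simp: simplicial_def)
    have "D = insert v (neighbors G v)" if "D \<in> maximal_cliques G" "v \<in> D" for D
      using that K clique_subset_neighbors unfolding maximal_cliques_def by blast
    then show "\<forall>D\<in>maximal_cliques G. v \<in> D \<longrightarrow> D = C" using assms by blast
  }
  {
    assume uniq: "\<forall>D\<in>maximal_cliques G. v \<in> D \<longrightarrow> D = C"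
    have "neighbors G v \<subseteq> C"
    proof
      fix u assume "u \<in> neighbors G v"
      then have "clique G {u, v}" "{u, v} \<subseteq> pverts G"
        using arcs_symmetric wellformed' by (auto simp: clique_def neighbors_def)
      then obtain D where "D \<in> maximal_cliques G" "{u, v} \<subseteq> D"
        using maximal_cliques_in_extend[OF pair_finite_verts] maximal_cliques_in_pverts by metis
      then show "u \<in> C" using uniq by blast
    qed
    moreover have "clique G C" using assms(1) by (simp add: maximal_cliques_def)
    ultimately show "simplicial G v"
      using v clique_mono by (auto simp: simplicial_def)
  }
qed

lemma Sep_eq:
  assumes "C \<in> maximal_cliques G"
  shows "Sep G C = C \<inter> \<Union> (maximal_cliques G - {C})"
  using simplicial_iff_unique_maximal_clique[OF assms] by (auto simp: Sep_def Simp_def)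

text \<open>Every path from \<open>C\<close> to another maximal clique starts with the only arc out
  of \<open>C\<close>. Its head \<open>C'\<close> thus contains all that \<open>C\<close> shares
  with other maximal cliques, and is itself one of these.\<close>

lemma simply_separated_if_endpoint:
  assumes T: "clique_tree G T" and "endpoint T C"
  shows "simply_separated G C"
proof -
  interpret T: pair_graph T using T by (simp add: clique_tree_def undirected_tree_def)
  have verts: "pverts T = maximal_cliques G" using T by (simp add: clique_tree_def)
  have C: "C \<in> maximal_cliques G" using assms(2) verts by (simp add: endpoint_def)
  have "card (out_arcs T C) = 1"
    using assms(2) by (simp add: endpoint_def out_degree_def)
  then obtain e where e: "out_arcs T C = {e}" by (auto simp: card_1_singleton_iff)
  define C' where "C' = snd e"
  have "e \<in> out_arcs T C" using e by simp
  then have e': "(C, C') \<in> parcs T" "e = (C, C')" by (auto simp: out_arcs_def C'_def)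
  then have C': "C' \<in> maximal_cliques G" "C' \<noteq> C"
    using T.wellformed' T.no_loops' verts by blast+
  have "C \<inter> D \<subseteq> C'" if D: "D \<in> maximal_cliques G" "D \<noteq> C" for D
  proof -
    have "connected T" using T by (simp add: clique_tree_def undirected_tree_def)
    then have "C \<rightarrow>\<^sup>*\<^bsub>T\<^esub> D" using C D verts by (simp add: T.connected_iff_reachable)
    then obtain p where p: "T.apath C p D" by (auto simp: T.reachable_apath)
    then obtain a q where q: "p = a # q" using D(2) by (cases p) (auto simp: T.apath_Nil_iff)
    with p have "a \<in> out_arcs T C" by (auto simp: T.apath_Cons_iff out_arcs_def)
    then have a: "a = (C, C')" using e e' by simp
    then have "T.apath C' q D" using p q by (simp add: T.apath_Cons_iff)
    then have "C' \<in> set (pawalk_verts C p)" using T.hd_in_awalk_verts(2) q a by simp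
    then show ?thesis using T C D(1) p unfolding clique_tree_def by blast
  qed
  then have Sep: "Sep G C = C \<inter> C'" using C' unfolding Sep_eq[OF C] by blast
  \<comment> \<open>Otherwise \<open>C = Sep G C\<close> would be contained in \<open>C'\<close>,
    against maximality.\<close>
  moreover have "Simp G C \<noteq> {}"
  proof
    assume "Simp G C = {}"
    then have "C \<subseteq> C'" using Sep by (auto simp: Sep_def)
    moreover have "C' = C" if "C \<subseteq> C'" using that C C'(1) unfolding maximal_cliques_def by blast
    ultimately show False using C'(2) by blast
  qed
  ultimately show ?thesis using C C' by (auto simp: simply_separated_def)
qed

lemma endpoint_if_simply_separated:
  assumes "chordal G" "simply_separated G C"
  obtains T where "clique_tree G T" "endpoint T C"
proof -
  have C: "C \<in> maximal_cliques G" and ne: "Simp G C \<noteq> {}"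
    using assms(2) by (auto simp: simply_separated_def)
  obtain C' where C': "C' \<in> maximal_cliques G" "Sep G C = C \<inter> C'"
    using assms(2) by (auto simp: simply_separated_def)
  have "C' \<noteq> C" using ne C'(2) by (auto simp: Sep_def Simp_def)
  define S where "S = pverts G - Simp G C"
  let ?F = "maximal_cliques G - {C}"
  \<comment> \<open>Simplicial vertices of \<open>C\<close> lie in no other maximal clique.\<close>
  have FS: "D \<subseteq> S" if "D \<in> ?F" for D
    using that simplicial_iff_unique_maximal_clique[OF C]
    by (auto simp: S_def Simp_def maximal_cliques_def clique_def)
  have "maximal_cliques_in G S = ?F"
  proof (intro equalityI subsetI)
    fix K assume K: "K \<in> maximal_cliques_in G S"
    then have "K \<subseteq> pverts G" "clique G K" by (auto simp: maximal_cliques_in_def clique_def)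
    then obtain D where D: "D \<in> maximal_cliques G" "K \<subseteq> D"
      using maximal_cliques_in_extend[OF pair_finite_verts] maximal_cliques_in_pverts by metis
    \<comment> \<open>Simple separation enters here: if \<open>K\<close> extends to
      \<open>C\<close>, it avoids \<open>Simp G C\<close>, so it lies in
      \<open>C \<inter> C'\<close> and \<open>C'\<close> can replace \<open>C\<close>.\<close>
    have "\<exists>D\<in>?F. K \<subseteq> D"
    proof (cases "D = C")
      case True
      then have "K \<subseteq> Sep G C" using D(2) K by (auto simp: maximal_cliques_in_def S_def Sep_def)
      then show ?thesis using C' \<open>C' \<noteq> C\<close> by blast
    qed (use D in blast)
    then obtain D' where "D' \<in> ?F" "K \<subseteq> D'" by blast
    moreover from this have "D' = K"
      using K FS unfolding maximal_cliques_in_def maximal_cliques_def by blast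
    ultimately show "K \<in> ?F" by simp
  next
    fix D assume "D \<in> ?F"
    then show "D \<in> maximal_cliques_in G S"
      using FS unfolding maximal_cliques_in_def maximal_cliques_def by blast
  qed
  moreover have "finite S" "S \<subseteq> pverts G" by (auto simp: S_def pair_finite_verts)
  ultimately have "running_intersection ?F"
    using running_intersection_maximal_cliques_in[OF assms(1)] by metis
  then obtain T where T: "junction_tree ?F T"
    using running_intersection_junction_tree by blast
  have "C \<inter> \<Union> ?F \<subseteq> C'" using Sep_eq[OF C] C'(2) by blast
  then have "junction_tree (insert C ?F) (add_leaf T C' C)" "endpoint (add_leaf T C' C) C"
    using junction_tree_add_leaf[OF T, of C' C] C' \<open>C' \<noteq> C\<close> by auto
  moreover have "insert C ?F = maximal_cliques G" using C by blast
  ultimately show thesis using that by (simp add: clique_tree_iff_junction_tree)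
qed

end

theorem theorem3p2:
  fixes G :: "'a pair_pre_digraph" and C :: "'a set"
  assumes "pair_graph G"
    and "connected G"
    and "chordal G"
    and "C \<in> maximal_cliques G"
  shows "(\<exists>T. clique_tree G T \<and> endpoint T C) \<longleftrightarrow> simply_separated G C"
  using pair_graph.simply_separated_if_endpoint[OF assms(1)]
    pair_graph.endpoint_if_simply_separated[OF assms(1,3)]
  by metis

end
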